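(* Let $a\in\mathbb{R}$, $\mu_1,\mu_2\in\mathbb{R}$, $\sigma_1,\sigma_2>0$. Let $X$ and $Z$ be the solutions of $$\mathrm{d} X_t=(\mu_1 \mathbf{1}_{\{X_t \le a\}}+\mu_2 \mathbf{1}_{\{X_t> a\}})\,\mathrm{d} t+(\sigma_1\mathbf{1}_{\{X_t\le a\}}+\sigma_2\mathbf{1}_{\{X_t> a\}})\,\mathrm{d} B_t ,$$ $$\mathrm{d} Z_t=(-\mu_1 \mathbf{1}_{\{Z_t \le a\}}-\mu_2 \mathbf{1}_{\{Z_t> a\}})\,\mathrm{d} t+(\sigma_1\mathbf{1}_{\{Z_t\le a\}}+\sigma_2\mathbf{1}_{\{Z_t> a\}})\,\mathrm{d} B_t ,$$ and let $p_X$, $p_Z$ be their transition densities. Then $$p_{X}(t;x,z)=p_{Z}(t;z,x)\quad\text{for all } t>0 \text{ and } x, z\in \mathbb{R}$$ if and only if $\mu_1=\mu_2$ and $\sigma_1=\sigma_2$.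
   Context: $B$ is a standard one-dimensional Brownian motion; each equation is known to have a unique strong solution. For parameters $(a,\mu_1,\mu_2,\sigma_1,\sigma_2)$, the transition density $p(t;x,z)$ of $X$ (density in $z$ of the law of $X_t$ given $X_0=x$) is understood as the following version, where $h(t ; x, \mu):=\frac{|x|}{\sqrt{2 \pi t^3}} \exp [-\frac{(x+\mu t)^2}{2 t}]$ for $t>0$, $x,\mu\in\mathbb{R}$. For $x\ge a$, $z\ge a$: $$\begin{aligned}p(t;x,z)=\;&\frac{2}{\sigma_2^2} \int_0^{\infty}\!\! \int_0^{t} e^{\frac{2\mu_2(z-a)}{\sigma_2^2}}e^{\frac{2\mu_1b}{\sigma_1^2}}\, h\!\left(t-\tau ; \tfrac{b}{\sigma_1}, \tfrac{\mu_1}{\sigma_1}\right) h\!\left(\tau ;\tfrac{z+x-2a+b}{\sigma_2},\tfrac{ \mu_2}{\sigma_2}\right) \mathrm{d} \tau\, \mathrm{d} b\\ &+\frac{1}{\sqrt{2 \pi t\sigma_2^2}} \left[\exp \left(-\frac{(z-x-\mu_2t)^2}{2 t\sigma_2^2}\right)-\exp \left(-\frac{(z+x-2a-\mu_2t)^2}{2t\sigma_2^2}-\frac{2 \mu_2(x-a)}{\sigma_2^2}\right)\right].\end{aligned}$$ For $x\ge a$, $z<a$: $$p(t;x,z)=\frac{2}{\sigma_1^2} \int_0^{\infty}\!\! \int_0^{t} e^{\frac{2\mu_1b}{\sigma_1^2}}\, h\!\left(t-\tau ; \tfrac{b-z+a}{\sigma_1}, \tfrac{\mu_1}{\sigma_1}\right)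 h\!\left(\tau ;\tfrac{x-a+b}{\sigma_2},\tfrac{ \mu_2}{\sigma_2}\right) \mathrm{d} \tau\, \mathrm{d} b.$$ For $x<a$, $z\le a$: $$\begin{aligned}p(t;x,z)=\;&\frac{2}{\sigma_1^2} \int_{-\infty}^{0}\! \int_0^{t} e^{\frac{2\mu_1(z-a)}{\sigma_1^2}} e^{\frac{2\mu_2b}{\sigma_2^2}}\, h\!\left(t-\tau ; \tfrac{b}{\sigma_2}, \tfrac{\mu_2}{\sigma_2}\right) h\!\left(\tau ;\tfrac{z+x-2a+b}{\sigma_1},\tfrac{ \mu_1}{\sigma_1}\right) \mathrm{d} \tau\, \mathrm{d} b\\ &+\frac{1}{\sqrt{2 \pi t\sigma_1^2}} \left[\exp \left(-\frac{(z-x-\mu_1t)^2}{2 t\sigma_1^2}\right)-\exp \left(-\frac{(z+x-2a-\mu_1t)^2}{2t\sigma_1^2}-\frac{2 \mu_1(x-a)}{\sigma_1^2}\right)\right].\end{aligned}$$ For $x<a$, $z>a$: $$p(t;x,z)=\frac{2}{\sigma_2^2} \int_{-\infty}^{0}\! \int_0^{t} e^{\frac{2\mu_2b}{\sigma_2^2}}\, h\!\left(t-\tau ; \tfrac{b-z+a}{\sigma_2}, \tfrac{\mu_2}{\sigma_2}\right) h\!\left(\tau ;\tfrac{x-a+b}{\sigma_1},\tfrac{ \mu_1}{\sigma_1}\right) \mathrm{d} \tau\, \mathrm{d} b.$$ Then $p_X$ is $p$ with parameters $(a,\mu_1,\mu_2,\sigma_1,\sigma_2)$ and $p_Z$ is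 $p$ with parameters $(a,-\mu_1,-\mu_2,\sigma_1,\sigma_2)$. *)

theory Defs
  imports "HOL-Probability.Probability"
begin

section \<open>Brownian motion, the Ito integral and strong solutions\<close>

text \<open>
  Processes are functions of time and of the sample point. Only times \<open>t \<ge> 0\<close> carry
  information; a filtration on \<open>[0,\<infinity>)\<close> is extended to negative times by \<open>F t = F 0\<close>.
\<close>

locale brownian_motion = prob_space M + filtration "space M" F
  for M :: "'w measure" and F :: "real \<Rightarrow> 'w measure" +
  fixes B :: "real \<Rightarrow> 'w \<Rightarrow> real"
  assumes subalg: "\<And>t. subalgebra M (F t)"
    and adapted: "\<And>t. t \<ge> 0 \<Longrightarrow> B t \<in> borel_measurable (F t)"
    and start: "AE \<omega> in M. B 0 \<omega> = 0"
    and paths: "\<And>\<omega>. \<omega> \<in> space M \<Longrightarrow> continuous_on {0..} (\<lambda>t. B t \<omega>)"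
    and gaussian_increments: "\<And>s t. 0 \<le> s \<Longrightarrow> s < t \<Longrightarrow>
          distributed M lborel (\<lambda>\<omega>. B t \<omega> - B s \<omega>)
            (\<lambda>y. ennreal (normal_density 0 (sqrt (t - s)) y))"
    and indep_increments: "\<And>s t. 0 \<le> s \<Longrightarrow> s < t \<Longrightarrow>
          indep_set (sets (F s)) {(\<lambda>\<omega>. B t \<omega> - B s \<omega>) -` A \<inter> space M | A. A \<in> sets borel}"

text \<open>
  A triple \<open>n, s, \<xi>\<close> encodes the simple process with the bounded, \<open>F (s i)\<close>-measurable
  value \<open>\<xi> i\<close> on the interval \<open>(s i, s (i+1)]\<close> for \<open>i < n\<close>, and the value \<open>0\<close> elsewhere.
\<close>

definition simple_integrand ::
  "(real \<Rightarrow> 'w measure) \<Rightarrow> nat \<Rightarrow> (nat \<Rightarrow> real) \<Rightarrow> (nat \<Rightarrow> 'w \<Rightarrow> real) \<Rightarrow> bool" where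
  "simple_integrand F n s \<xi> \<longleftrightarrow>
     0 \<le> s 0 \<and> (\<forall>i<n. s i \<le> s (Suc i)) \<and>
     (\<forall>i<n. \<xi> i \<in> borel_measurable (F (s i)) \<and>
            (\<exists>C. \<forall>\<omega>\<in>space (F (s i)). \<bar>\<xi> i \<omega>\<bar> \<le> C))"

definition simple_value ::
  "nat \<Rightarrow> (nat \<Rightarrow> real) \<Rightarrow> (nat \<Rightarrow> 'w \<Rightarrow> real) \<Rightarrow> real \<Rightarrow> 'w \<Rightarrow> real" where
  "simple_value n s \<xi> u \<omega> = (\<Sum>i<n. \<xi> i \<omega> * indicator {s i<..s (Suc i)} u)"

definition simple_ito ::
  "(real \<Rightarrow> 'w \<Rightarrow> real) \<Rightarrow> nat \<Rightarrow> (nat \<Rightarrow> real) \<Rightarrow> (nat \<Rightarrow> 'w \<Rightarrow> real) \<Rightarrow> real \<Rightarrow> 'w \<Rightarrow> real" where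
  "simple_ito B n s \<xi> t \<omega> = (\<Sum>i<n. \<xi> i \<omega> * (B (min t (s (Suc i))) \<omega> - B (min t (s i)) \<omega>))"

text \<open>
  \<open>Y\<close> is (a version of) the Ito integral of \<open>H\<close> against \<open>B\<close> over \<open>[0,t]\<close>: the limit in
  \<open>L\<^sup>2(M)\<close> of the integrals of simple processes that converge to \<open>H\<close> in
  \<open>L\<^sup>2([0,t] \<times> M)\<close>. By the Ito isometry \<open>Y\<close> is unique up to null sets. This covers
  all square-integrable integrands, in particular the bounded ones used below.
\<close>

definition has_ito_integral ::
  "'w measure \<Rightarrow> (real \<Rightarrow> 'w measure) \<Rightarrow> (real \<Rightarrow> 'w \<Rightarrow> real) \<Rightarrow>
   (real \<Rightarrow> 'w \<Rightarrow> real) \<Rightarrow> real \<Rightarrow> ('w \<Rightarrow> real) \<Rightarrow> bool" where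
  "has_ito_integral M F B H t Y \<longleftrightarrow>
     Y \<in> borel_measurable M \<and>
     (\<exists>n s \<xi>. (\<forall>k::nat. simple_integrand F (n k) (s k) (\<xi> k)) \<and>
        ((\<lambda>k. \<integral>\<^sup>+\<omega>. (\<integral>\<^sup>+u\<in>{0..t}.
            ennreal ((simple_value (n k) (s k) (\<xi> k) u \<omega> - H u \<omega>)\<^sup>2) \<partial>lborel) \<partial>M) \<longlonglongrightarrow> 0) \<and>
        ((\<lambda>k. \<integral>\<^sup>+\<omega>.
            ennreal ((simple_ito B (n k) (s k) (\<xi> k) t \<omega> - Y \<omega>)\<^sup>2) \<partial>M) \<longlonglongrightarrow> 0))"

text \<open>\<open>dX\<^sub>t = b(X\<^sub>t) dt + \<sigma>(X\<^sub>t) dB\<^sub>t\<close> with \<open>X\<^sub>0 = x\<close>, in integral form.\<close>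

definition sde_solution ::
  "'w measure \<Rightarrow> (real \<Rightarrow> 'w measure) \<Rightarrow> (real \<Rightarrow> 'w \<Rightarrow> real) \<Rightarrow>
   (real \<Rightarrow> real) \<Rightarrow> (real \<Rightarrow> real) \<Rightarrow> real \<Rightarrow> (real \<Rightarrow> 'w \<Rightarrow> real) \<Rightarrow> bool" where
  "sde_solution M F B b \<sigma> x X \<longleftrightarrow>
     (\<forall>t\<ge>0. X t \<in> borel_measurable (F t)) \<and>
     (\<forall>\<omega>\<in>space M. continuous_on {0..} (\<lambda>t. X t \<omega>)) \<and>
     (\<forall>t\<ge>0. \<exists>Y. has_ito_integral M F B (\<lambda>s \<omega>. \<sigma> (X s \<omega>)) t Y \<and>
        (AE \<omega> in M. X t \<omega> = x + (LBINT s:{0..t}. b (X s \<omega>)) + Y \<omega>))"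

definition two_valued :: "real \<Rightarrow> real \<Rightarrow> real \<Rightarrow> real \<Rightarrow> real" where
  "two_valued a c\<^sub>1 c\<^sub>2 y = c\<^sub>1 * indicator {..a} y + c\<^sub>2 * indicator {a<..} y"

section \<open>Transition densities\<close>

text \<open>\<open>X x\<close> is the solution started at \<open>x\<close>, and \<open>p t x\<close> is a density of the law of \<open>X x t\<close>.\<close>

definition transition_density ::
  "'w measure \<Rightarrow> (real \<Rightarrow> real \<Rightarrow> 'w \<Rightarrow> real) \<Rightarrow> (real \<Rightarrow> real \<Rightarrow> real \<Rightarrow> real) \<Rightarrow> bool" where
  "transition_density M X p \<longleftrightarrow>
     (\<forall>x. \<forall>t>0. distributed M lborel (X x t) (\<lambda>z. ennreal (p t x z)))"

definition hit :: "real \<Rightarrow> real \<Rightarrow> real \<Rightarrow> real" where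
  "hit t x \<mu> = \<bar>x\<bar> / sqrt (2 * pi * t ^ 3) * exp (- ((x + \<mu> * t)\<^sup>2 / (2 * t)))"

text \<open>
  A density determines \<open>p t x\<close> only almost everywhere. The following function fixes its
  values at all points, including those with \<open>x = a\<close> or \<open>z = a\<close>.
\<close>

definition density_version ::
  "real \<Rightarrow> real \<Rightarrow> real \<Rightarrow> real \<Rightarrow> real \<Rightarrow> real \<Rightarrow> real \<Rightarrow> real \<Rightarrow> real" where
  "density_version a \<mu>\<^sub>1 \<mu>\<^sub>2 \<sigma>\<^sub>1 \<sigma>\<^sub>2 t x z =
    (if x \<ge> a then
       if z \<ge> a then
         2 / \<sigma>\<^sub>2\<^sup>2 * (LBINT b:{0..}. LBINT \<tau>:{0..t}.
             exp (2 * \<mu>\<^sub>2 * (z - a) / \<sigma>\<^sub>2\<^sup>2) * exp (2 * \<mu>\<^sub>1 * b / \<sigma>\<^sub>1\<^sup>2) *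
             hit (t - \<tau>) (b / \<sigma>\<^sub>1) (\<mu>\<^sub>1 / \<sigma>\<^sub>1) *
             hit \<tau> ((z + x - 2 * a + b) / \<sigma>\<^sub>2) (\<mu>\<^sub>2 / \<sigma>\<^sub>2))
         + 1 / sqrt (2 * pi * t * \<sigma>\<^sub>2\<^sup>2) *
             (exp (- ((z - x - \<mu>\<^sub>2 * t)\<^sup>2 / (2 * t * \<sigma>\<^sub>2\<^sup>2)))
              - exp (- ((z + x - 2 * a - \<mu>\<^sub>2 * t)\<^sup>2 / (2 * t * \<sigma>\<^sub>2\<^sup>2))
                     - 2 * \<mu>\<^sub>2 * (x - a) / \<sigma>\<^sub>2\<^sup>2))
       else
         2 / \<sigma>\<^sub>1\<^sup>2 * (LBINT b:{0..}. LBINT \<tau>:{0..t}.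
             exp (2 * \<mu>\<^sub>1 * b / \<sigma>\<^sub>1\<^sup>2) *
             hit (t - \<tau>) ((b - z + a) / \<sigma>\<^sub>1) (\<mu>\<^sub>1 / \<sigma>\<^sub>1) *
             hit \<tau> ((x - a + b) / \<sigma>\<^sub>2) (\<mu>\<^sub>2 / \<sigma>\<^sub>2))
     else
       if z \<le> a then
         2 / \<sigma>\<^sub>1\<^sup>2 * (LBINT b:{..0}. LBINT \<tau>:{0..t}.
             exp (2 * \<mu>\<^sub>1 * (z - a) / \<sigma>\<^sub>1\<^sup>2) * exp (2 * \<mu>\<^sub>2 * b / \<sigma>\<^sub>2\<^sup>2) *
             hit (t - \<tau>) (b / \<sigma>\<^sub>2) (\<mu>\<^sub>2 / \<sigma>\<^sub>2) *
             hit \<tau> ((z + x - 2 * a + b) / \<sigma>\<^sub>1) (\<mu>\<^sub>1 / \<sigma>\<^sub>1))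
         + 1 / sqrt (2 * pi * t * \<sigma>\<^sub>1\<^sup>2) *
             (exp (- ((z - x - \<mu>\<^sub>1 * t)\<^sup>2 / (2 * t * \<sigma>\<^sub>1\<^sup>2)))
              - exp (- ((z + x - 2 * a - \<mu>\<^sub>1 * t)\<^sup>2 / (2 * t * \<sigma>\<^sub>1\<^sup>2))
                     - 2 * \<mu>\<^sub>1 * (x - a) / \<sigma>\<^sub>1\<^sup>2))
       else
         2 / \<sigma>\<^sub>2\<^sup>2 * (LBINT b:{..0}. LBINT \<tau>:{0..t}.
             exp (2 * \<mu>\<^sub>2 * b / \<sigma>\<^sub>2\<^sup>2) *
             hit (t - \<tau>) ((b - z + a) / \<sigma>\<^sub>2) (\<mu>\<^sub>2 / \<sigma>\<^sub>2) *
             hit \<tau> ((x - a + b) / \<sigma>\<^sub>1) (\<mu>\<^sub>1 / \<sigma>\<^sub>1)))"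

end

theory Submission
  imports Defs
begin

text \<open>
  Changing the sign of the drift multiplies \<open>hit s y m\<close> by \<open>exp (2 m y)\<close>, a factor
  independent of \<open>s\<close>. With \<open>k\<^sub>i = 2 \<mu>\<^sub>i / \<sigma>\<^sub>i\<^sup>2\<close>, the densities \<open>p\<^sub>X t x z\<close> and \<open>p\<^sub>Z t z x\<close> are
  therefore built from one and the same positive kernel \<open>G b\<close>. For \<open>x, z \<ge> a\<close> they differ only
  in that \<open>exp (k\<^sub>1 b)\<close> is replaced by \<open>exp (k\<^sub>2 b)\<close> under the integral over \<open>b \<ge> 0\<close>, so equality at
  a single point forces \<open>k\<^sub>1 = k\<^sub>2\<close>. For \<open>z < a < x\<close> they are
  \<open>2 / \<sigma>\<^sub>i\<^sup>2 \<cdot> \<integral> exp (k\<^sub>i b) G b db\<close> with \<open>i = 1\<close> and \<open>i = 2\<close>, so \<open>\<sigma>\<^sub>1 = \<sigma>\<^sub>2\<close> follows.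
  Since a divergent Bochner integral is \<open>0\<close>, both conclusions need the kernel to be integrable.
\<close>

section \<open>The first-passage kernel and its convolution in time\<close>

lemma hit_minus_drift: "hit s y (- m) = exp (2 * m * y) * hit s y m"
proof (cases "s = 0")
  case False
  then have "- ((y + - m * s)\<^sup>2 / (2 * s)) = 2 * m * y + - ((y + m * s)\<^sup>2 / (2 * s))"
    by (simp add: field_simps power2_eq_square)
  then show ?thesis
    by (simp only: hit_def exp_add mult_ac)
qed (simp add: hit_def)

text \<open>Mirror symmetry of space; it makes the half-line below \<open>a\<close> a copy of the
  one above.\<close>

lemma hit_minus: "hit s (- y) m = hit s y (- m)"
proof -
  have "(- y + m * s)\<^sup>2 = (y + - m * s)\<^sup>2"
    by (simp add: power2_eq_square algebra_simps)
  then show ?thesis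
    by (simp only: hit_def abs_minus_cancel)
qed

lemma hit_nonneg: "s \<ge> 0 \<Longrightarrow> hit s y m \<ge> 0"
  by (simp add: hit_def)

lemma hit_pos: "s > 0 \<Longrightarrow> y \<noteq> 0 \<Longrightarrow> hit s y m > 0"
  by (simp add: hit_def)

text \<open>Division by 0 yields 0, so products of two kernels vanish at both end points of the time
  interval.\<close>

lemma hit_0 [simp]: "hit 0 y m = 0"
  by (simp add: hit_def)

lemma hit_measurable [measurable (raw)]:
  assumes [measurable]: "f \<in> borel_measurable N" "g \<in> borel_measurable N"
  shows "(\<lambda>w. hit (f w) (g w) m) \<in> borel_measurable N"
  unfolding hit_def by measurable

text \<open>Up to exponential factors this is the inner integral of \<open>density_version\<close>
  at fixed \<open>b\<close>: the (possibly defective) density at \<open>t\<close> of a sum of two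
  independent first-passage times.\<close>

definition hit_conv :: "real \<Rightarrow> real \<Rightarrow> real \<Rightarrow> real \<Rightarrow> real \<Rightarrow> real" where
  "hit_conv t y m y' m' = (LBINT \<tau>:{0..t}. hit (t - \<tau>) y m * hit \<tau> y' m')"

lemma hit_conv_minus_drift:
  "hit_conv t y (- m) y' (- m') = exp (2 * m * y + 2 * m' * y') * hit_conv t y m y' m'"
  by (simp add: hit_conv_def hit_minus_drift exp_add mult_ac flip: set_integral_mult_right)

text \<open>Substitution of \<open>t - \<tau>\<close> for \<open>\<tau>\<close>. It is needed since
  reflection exchanges the two sides of \<open>a\<close> and hence the two kernels.\<close>

lemma hit_conv_commute: "hit_conv t y m y' m' = hit_conv t y' m' y m"
proof -
  have "hit_conv t y m y' m' =
      (LBINT \<tau>. indicat_real {0..t} (t + - 1 * \<tau>) *\<^sub>R (hit (t - (t + - 1 * \<tau>)) y m * hit (t + - 1 * \<tau>) y' m'))"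
    unfolding hit_conv_def set_lebesgue_integral_def
    by (subst lborel_integral_real_affine[where c = "-1" and t = t]) auto
  also have "\<dots> = hit_conv t y' m' y m"
    unfolding hit_conv_def set_lebesgue_integral_def
    by (intro Bochner_Integration.integral_cong) (auto simp: indicator_def)
  finally show ?thesis .
qed

section \<open>Bounds for the kernel and integrability of products of kernels\<close>

lemma powr_le_exp_quarter:
  fixes p q :: real
  assumes "0 \<le> p" "p \<le> 2" "0 < q"
  shows "q powr p \<le> 64 * exp (q / 4)"
proof -
  have "q powr p \<le> (1 + q) powr p"
    using assms by (intro powr_mono2) auto
  also have "\<dots> \<le> (1 + q) powr 2"
    using assms by (intro powr_mono) auto
  also have "\<dots> = (1 + q)\<^sup>2"
    using assms by simp
  \<comment> \<open>The 8 prepares \<open>1 + w \<le> exp w\<close> at \<open>w = q / 8\<close>,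
    whose square is \<open>exp (q / 4)\<close>; its own square is the constant 64.\<close>
  also have "\<dots> \<le> (8 * (1 + q / 8))\<^sup>2"
    using assms by (intro power_mono) auto
  also have "\<dots> = 64 * (1 + q / 8)\<^sup>2"
    by (simp only: power_mult_distrib) simp
  also have "(1 + q / 8)\<^sup>2 \<le> (exp (q / 8))\<^sup>2"
    using assms exp_ge_add_one_self[of "q / 8"] by (intro power_mono) auto
  also have "(exp (q / 8))\<^sup>2 = exp (q / 4)"
    by (simp flip: exp_double)
  finally show ?thesis by simp
qed

text \<open>
  With \<open>q = y\<^sup>2 / s\<close>, half of the Gaussian factor \<open>exp (- q / 2)\<close> pays for the power \<open>q\<^sup>p\<close> that turns
  \<open>y / s powr (3 / 2)\<close> into \<open>y powr (1 - 2 p) * s powr (p - 3 / 2)\<close>, the other half for the rate \<open>L\<close>.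
\<close>
lemma hit_le:
  assumes "0 \<le> p" "p \<le> 2" "0 < s" "s \<le> t" "0 < y"
  shows "hit s y m \<le> 64 * exp (t * (L - m)\<^sup>2) * (y powr (1 - 2 * p) * s powr (p - 3 / 2) * exp (- L * y))"
proof -
  define q where "q = y\<^sup>2 / s"
  have q: "q > 0"
    using assms by (simp add: q_def)
  have "q powr p = y powr (2 * p) / s powr p"
    using assms by (simp add: q_def powr_divide powr_powr flip: powr_numeral)
  then have "y powr (1 - 2 * p) * s powr (p - 3 / 2) * q powr p
      = (y powr (1 - 2 * p) * y powr (2 * p)) * (s powr (p - 3 / 2) / s powr p)"
    by simp
  also have "y powr (1 - 2 * p) * y powr (2 * p) = y"
    using assms by (simp flip: powr_add)
  also have "s powr (p - 3 / 2) / s powr p = 1 / s powr (3 / 2)"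
    by (simp add: powr_minus_divide flip: powr_diff)
  also have "s powr (3 / 2) = (s powr 3) powr (1 / 2)"
    by (simp only: powr_powr) simp
  also have "\<dots> = sqrt (s ^ 3)"
    using assms by (simp add: powr_half_sqrt)
  finally have eq: "y / sqrt (s ^ 3) = y powr (1 - 2 * p) * s powr (p - 3 / 2) * q powr p"
    by simp
  have "y / sqrt (2 * pi * s ^ 3) = y / sqrt (s ^ 3) / sqrt (2 * pi)"
    by (simp add: real_sqrt_mult)
  also have "\<dots> \<le> y / sqrt (s ^ 3) / 1"
    using assms pi_ge_two by (intro divide_left_mono) auto
  finally have le1: "y / sqrt (2 * pi * s ^ 3) \<le> y / sqrt (s ^ 3)"
    by simp
  have "- ((y + m * s)\<^sup>2 / (2 * s)) = - q / 2 - m * y - m\<^sup>2 * s / 2"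
    using assms by (simp add: q_def field_simps power2_eq_square)
  also have "\<dots> \<le> - q / 2 - m * y"
    using assms by simp
  finally have le2: "- ((y + m * s)\<^sup>2 / (2 * s)) \<le> - q / 2 - m * y" .
  \<comment> \<open>Completing the square in \<open>y\<close>: the term \<open>(L - m) * y\<close>
    costs a constant and \<open>y\<^sup>2 / (4 * t)\<close>, which \<open>s \<le> t\<close> bounds
    by \<open>q / 4\<close>.\<close>
  have "y\<^sup>2 / (4 * t) + t * (L - m)\<^sup>2 - (L - m) * y = (y - 2 * t * (L - m))\<^sup>2 / (4 * t)"
    using assms by (simp add: field_simps power2_eq_square)
  also have "\<dots> \<ge> 0"
    using assms by simp
  finally have "(L - m) * y \<le> y\<^sup>2 / (4 * t) + t * (L - m)\<^sup>2"
    by simp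
  also have "y\<^sup>2 / (4 * t) \<le> q / 4"
    unfolding q_def using assms by (simp add: frac_le)
  finally have le3: "- q / 4 - m * y \<le> t * (L - m)\<^sup>2 + (- L * y)"
    by (simp add: algebra_simps)
  have "hit s y m \<le> y / sqrt (s ^ 3) * exp (- q / 2 - m * y)"
    unfolding hit_def using assms le1 le2 by (intro mult_mono) auto
  also have "\<dots> = y powr (1 - 2 * p) * s powr (p - 3 / 2) * (q powr p * exp (- q / 2 - m * y))"
    by (simp add: eq)
  also have "q powr p * exp (- q / 2 - m * y) \<le> 64 * exp (q / 4) * exp (- q / 2 - m * y)"
    using assms q by (intro mult_right_mono powr_le_exp_quarter) auto
  also have "\<dots> = 64 * exp (- q / 4 - m * y)"
    by (simp flip: exp_add)
  also have "\<dots> \<le> 64 * exp (t * (L - m)\<^sup>2 + (- L * y))"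
    using le3 by simp
  finally have "hit s y m \<le> y powr (1 - 2 * p) * s powr (p - 3 / 2) *
      (64 * exp (t * (L - m)\<^sup>2 + (- L * y)))"
    by (simp add: mult_left_mono)
  then show ?thesis
    by (simp only: exp_add mult_ac)
qed

text \<open>The Gamma integrand with parameter \<open>p + 1\<close>, obtained as the norm of its
  complex version; Borel measurability carries integrability from \<open>lebesgue\<close> to
  \<open>lborel\<close>.\<close>

lemma integrable_powr_mult_exp_minus:
  fixes p :: real
  assumes "p > - 1"
  shows "set_integrable lborel {0<..} (\<lambda>s. s powr p * exp (- s))"
proof -
  have "set_integrable lebesgue {0<..}
      (\<lambda>s. complex_of_real s powr (complex_of_real (p + 1) - 1) / of_real (exp s))"
    using assms by (intro absolutely_integrable_Gamma_integral') auto
  then have "set_integrable lebesgue {0<..}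
      (\<lambda>s. norm (complex_of_real s powr (complex_of_real (p + 1) - 1) / of_real (exp s)))"
    by (rule set_integrable_norm)
  also have "?this \<longleftrightarrow> set_integrable lebesgue {0<..} (\<lambda>s. s powr p * exp (- s))"
    by (intro set_integrable_cong)
      (auto simp: norm_divide norm_powr_real_powr exp_minus field_simps)
  finally show ?thesis
    unfolding set_integrable_def by (subst (asm) integrable_completion) auto
qed

text \<open>A nonnegative function with integral 0 vanishes almost everywhere, so the interval on
  which \<open>f\<close> is positive would be a null set despite its positive length.\<close>

lemma set_integral_pos:
  fixes f :: "real \<Rightarrow> real"
  assumes int: "set_integrable lborel S f"
    and nonneg: "\<And>x. x \<in> S \<Longrightarrow> 0 \<le> f x"
    and pos: "\<And>x. x \<in> {c<..<d} \<Longrightarrow> 0 < f x"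
    and "{c<..<d} \<subseteq> S" "c < d"
  shows "0 < (LBINT x:S. f x)"
proof -
  let ?g = "\<lambda>x. indicat_real S x *\<^sub>R f x"
  have g0: "AE x in lborel. 0 \<le> ?g x"
    using nonneg by (auto simp: indicator_def)
  have "\<not> (AE x in lborel. ?g x = 0)"
  proof
    assume "AE x in lborel. ?g x = 0"
    then have "AE x in lborel. x \<notin> {c<..<d}"
      by eventually_elim (use pos assms(4) in \<open>fastforce simp: indicator_def\<close>)
    then have "{c<..<d} \<in> null_sets lborel"
      by (subst AE_iff_null_sets) auto
    with \<open>c < d\<close> show False
      by (simp add: null_sets_def)
  qed
  with int g0 have "(LBINT x:S. f x) \<noteq> 0"
    unfolding set_lebesgue_integral_def set_integrable_def
    by (subst integral_nonneg_eq_0_iff_AE) auto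
  moreover have "0 \<le> (LBINT x:S. f x)"
    unfolding set_lebesgue_integral_def using g0 by (rule integral_nonneg_AE)
  ultimately show ?thesis
    by simp
qed

text \<open>
  The exponents \<open>p = 3 / 4\<close> and \<open>p = 3 / 2\<close> in \<open>hit_le\<close> leave singularities at \<open>\<tau> = t\<close> and \<open>y = 0\<close>
  that are integrable; the factor \<open>exp (- (t - \<tau>))\<close> only serves to reach a Gamma integrand.
\<close>
lemma hit_mult_le:
  assumes "0 < y" "0 < c" "c \<le> y'" "0 \<le> \<tau>" "\<tau> \<le> t"
  shows "hit (t - \<tau>) y m * hit \<tau> y' m' \<le>
      4096 * exp t * exp (t * m\<^sup>2) * exp (t * (L - m')\<^sup>2) * c powr (- 2) * y powr (- 1 / 2) * exp (- L * y')
        * (indicat_real {0<..} (t - \<tau>) * ((t - \<tau>) powr (- 3 / 4) * exp (- (t - \<tau>))))"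
    (is "_ \<le> ?R")
proof (cases "\<tau> = 0 \<or> \<tau> = t")
  case True
  then show ?thesis
    by (auto simp: indicator_def)
next
  case False
  with assms have \<tau>: "0 < \<tau>" "0 < t - \<tau>"
    by auto
  have "hit (t - \<tau>) y m \<le> 64 * exp (t * (0 - m)\<^sup>2) *
      (y powr (1 - 2 * (3 / 4)) * (t - \<tau>) powr (3 / 4 - 3 / 2) * exp (- 0 * y))"
    using assms \<tau> by (intro hit_le) auto
  also have "\<dots> = 64 * exp (t * m\<^sup>2) * (y powr (- 1 / 2) * (t - \<tau>) powr (- 3 / 4) * 1)"
    by simp
  also have "\<dots> \<le> 64 * exp (t * m\<^sup>2) * (y powr (- 1 / 2) * (t - \<tau>) powr (- 3 / 4) * exp \<tau>)"
    using \<tau> by (intro mult_left_mono) auto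
  also have "exp \<tau> = exp t * exp (- (t - \<tau>))"
    by (simp flip: exp_add)
  finally have 1: "hit (t - \<tau>) y m \<le> 64 * exp (t * m\<^sup>2) *
      (y powr (- 1 / 2) * (t - \<tau>) powr (- 3 / 4) * (exp t * exp (- (t - \<tau>))))" .
  \<comment> \<open>With \<open>p = 3 / 2\<close> the power of \<open>\<tau>\<close> disappears; the
    resulting power -2 of \<open>y'\<close> is bounded because \<open>c \<le> y'\<close>.\<close>
  have "hit \<tau> y' m' \<le> 64 * exp (t * (L - m')\<^sup>2) *
      (y' powr (1 - 2 * (3 / 2)) * \<tau> powr (3 / 2 - 3 / 2) * exp (- L * y'))"
    using assms \<tau> by (intro hit_le) auto
  also have "\<dots> = 64 * exp (t * (L - m')\<^sup>2) * (y' powr (- 2) * exp (- L * y'))"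
    using \<tau> by simp
  also have "\<dots> \<le> 64 * exp (t * (L - m')\<^sup>2) * (c powr (- 2) * exp (- L * y'))"
    using assms by (intro mult_left_mono mult_right_mono powr_mono2') auto
  finally have 2: "hit \<tau> y' m' \<le> 64 * exp (t * (L - m')\<^sup>2) * (c powr (- 2) * exp (- L * y'))" .
  from 1 2 have "hit (t - \<tau>) y m * hit \<tau> y' m' \<le>
     (64 * exp (t * m\<^sup>2) * (y powr (- 1 / 2) * (t - \<tau>) powr (- 3 / 4) * (exp t * exp (- (t - \<tau>)))))
     * (64 * exp (t * (L - m')\<^sup>2) * (c powr (- 2) * exp (- L * y')))"
    using \<tau> by (intro mult_mono hit_nonneg) auto
  also have "\<dots> = ?R"
    using \<tau> by simp
  finally show ?thesis .
qed

text \<open>Dominated by the majorant of \<open>hit_mult_le\<close> with \<open>c = y'\<close> and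
  rate 0, a reflected and shifted Gamma integrand.\<close>

lemma integrable_hit_mult:
  assumes "t > 0" "0 < y" "0 < y'"
  shows "set_integrable lborel {0..t} (\<lambda>\<tau>. hit (t - \<tau>) y m * hit \<tau> y' m')"
proof -
  let ?g = "\<lambda>s. indicat_real {0<..} s * (s powr (- 3 / 4) * exp (- s))"
  have "integrable lborel ?g"
    using integrable_powr_mult_exp_minus[of "- 3 / 4"] by (simp add: set_integrable_def)
  then have "integrable lborel (\<lambda>\<tau>. ?g (t + - 1 * \<tau>))"
    by (rule lborel_integrable_real_affine) simp
  then have g: "integrable lborel (\<lambda>\<tau>. 4096 * exp t * exp (t * m\<^sup>2) * exp (t * (0 - m')\<^sup>2) *
      y' powr (- 2) * y powr (- 1 / 2) * exp (- 0 * y') * ?g (t - \<tau>))"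
    by (intro integrable_mult_right) simp
  show ?thesis
    unfolding set_integrable_def
  proof (rule Bochner_Integration.integrable_bound[OF g], measurable, intro AE_I2)
    fix \<tau>
    show "norm (indicat_real {0..t} \<tau> *\<^sub>R (hit (t - \<tau>) y m * hit \<tau> y' m')) \<le>
      norm (4096 * exp t * exp (t * m\<^sup>2) * exp (t * (0 - m')\<^sup>2) *
      y' powr (- 2) * y powr (- 1 / 2) * exp (- 0 * y') * ?g (t - \<tau>))"
    proof (cases "0 \<le> \<tau> \<and> \<tau> \<le> t")
      case True
      with assms hit_mult_le[of y y' y' \<tau> t m m' 0] show ?thesis
        by (simp add: hit_nonneg abs_mult)
    next
      case False
      then have "indicat_real {0..t} \<tau> = 0"
        by auto
      then show ?thesis
        by simp
    qed
  qed
qed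

section \<open>Positivity and decay of the time convolution\<close>

lemma hit_conv_pos: "t > 0 \<Longrightarrow> 0 < y \<Longrightarrow> 0 < y' \<Longrightarrow> 0 < hit_conv t y m y' m'"
  unfolding hit_conv_def
  by (rule set_integral_pos[OF integrable_hit_mult, where c = 0 and d = t])
    (auto simp: hit_nonneg hit_pos)

lemma hit_conv_nonneg: "0 \<le> hit_conv t y m y' m'"
  unfolding hit_conv_def set_lebesgue_integral_def
  by (intro integral_nonneg_AE AE_I2) (auto simp: indicator_def hit_nonneg)

lemma hit_conv_measurable [measurable (raw)]:
  assumes [measurable]: "f \<in> borel_measurable N" "g \<in> borel_measurable N"
  shows "(\<lambda>w. hit_conv t (f w) m (g w) m') \<in> borel_measurable N"
  unfolding hit_conv_def set_lebesgue_integral_def by measurable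

text \<open>Integrating \<open>hit_mult_le\<close> over \<open>\<tau>\<close> gives one constant for
  all \<open>y\<close> and \<open>y'\<close>. The rate \<open>L\<close> is free, so that any
  exponential weight can be absorbed later.\<close>

lemma hit_conv_le:
  assumes "t > 0" "0 < c"
  obtains C where "C \<ge> 0"
    "\<And>y y'. 0 < y \<Longrightarrow> c \<le> y' \<Longrightarrow> hit_conv t y m y' m' \<le> C * (y powr (- 1 / 2) * exp (- L * y'))"
proof
  define g where "g = (\<lambda>s::real. indicat_real {0<..} s * (s powr (- 3 / 4) * exp (- s)))"
  define D where "D = 4096 * exp t * exp (t * m\<^sup>2) * exp (t * (L - m')\<^sup>2) * c powr (- 2)"
  have "integrable lborel g"
    using integrable_powr_mult_exp_minus[of "- 3 / 4"] by (simp add: set_integrable_def g_def)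
  then have "integrable lborel (\<lambda>\<tau>. g (t + - 1 * \<tau>))"
    by (rule lborel_integrable_real_affine) simp
  then have g: "integrable lborel (\<lambda>\<tau>. g (t - \<tau>))"
    by simp
  have g0: "g s \<ge> 0" for s
    by (simp add: g_def)
  have D: "D \<ge> 0"
    by (simp add: D_def)
  show "D * (LBINT \<tau>. g (t - \<tau>)) \<ge> 0"
    using g0 D by simp
  fix y y' :: real
  assume y: "0 < y" "c \<le> y'"
  define K where "K = D * y powr (- 1 / 2) * exp (- L * y')"
  have "hit_conv t y m y' m' \<le> (LBINT \<tau>. K * g (t - \<tau>))"
    unfolding hit_conv_def set_lebesgue_integral_def
  proof (rule integral_mono)
    show "integrable lborel (\<lambda>\<tau>. indicat_real {0..t} \<tau> *\<^sub>R (hit (t - \<tau>) y m * hit \<tau> y' m'))"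
      using integrable_hit_mult[of t y y' m m'] assms y by (simp add: set_integrable_def)
    show "integrable lborel (\<lambda>\<tau>. K * g (t - \<tau>))"
      using g by simp
    show "indicat_real {0..t} \<tau> *\<^sub>R (hit (t - \<tau>) y m * hit \<tau> y' m') \<le> K * g (t - \<tau>)" for \<tau>
    proof (cases "0 \<le> \<tau> \<and> \<tau> \<le> t")
      case True
      with hit_mult_le[of y c y' \<tau> t m m' L] assms y show ?thesis
        by (simp add: K_def D_def g_def)
    next
      case False
      then show ?thesis
        using g0[of "t - \<tau>"] D by (auto simp: K_def indicator_def)
    qed
  qed
  also have "\<dots> = K * (LBINT \<tau>. g (t - \<tau>))"
    using g by simp
  finally show "hit_conv t y m y' m' \<le> D * (LBINT \<tau>. g (t - \<tau>)) * (y powr (- 1 / 2) * exp (- L * y'))"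
    by (simp add: K_def mult_ac)
qed

section \<open>Exponentially weighted integrals over \<open>b\<close>\<close>

lemma integrable_exp_mult_hit_conv:
  assumes "t > 0" "\<sigma> > 0" "\<sigma>' > 0" "v \<ge> 0" "u > 0"
  shows "set_integrable lborel {0..} (\<lambda>b. exp (k * b) * hit_conv t ((b + v) / \<sigma>) m ((b + u) / \<sigma>') m')"
proof -
  \<comment> \<open>This rate turns \<open>exp (- L * ((b + u) / \<sigma>'))\<close> into
    \<open>exp (- (k + 1) * (b + u))\<close>, which leaves \<open>exp (- b)\<close> after the weight
    \<open>exp (k * b)\<close>.\<close>
  define L where "L = \<sigma>' * (k + 1)"
  obtain C where C: "C \<ge> 0"
    "\<And>y y'. 0 < y \<Longrightarrow> u / \<sigma>' \<le> y' \<Longrightarrow> hit_conv t y m y' m' \<le> C * (y powr (- 1 / 2) * exp (- L * y'))"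
    by (rule hit_conv_le[where t = t and c = "u / \<sigma>'" and m = m and m' = m' and L = L])
      (use assms in auto)
  define D where "D = C * (1 / \<sigma>) powr (- 1 / 2) * exp (- (k + 1) * u)"
  have "integrable lborel (\<lambda>b. D * (indicat_real {0<..} b * (b powr (- 1 / 2) * exp (- b))))"
    using integrable_powr_mult_exp_minus[of "- 1 / 2"]
    by (intro integrable_mult_right) (simp add: set_integrable_def)
  then show ?thesis
    unfolding set_integrable_def
  proof (rule Bochner_Integration.integrable_bound)
    show "(\<lambda>b. indicat_real {0..} b *\<^sub>R (exp (k * b) * hit_conv t ((b + v) / \<sigma>) m ((b + u) / \<sigma>') m'))
        \<in> borel_measurable lborel"
      by measurable
    \<comment> \<open>The majorant is 0 at \<open>b = 0\<close>, so this point is discarded as a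
      null set.\<close>
    have "AE b in lborel. b \<noteq> (0::real)"
      by (rule AE_lborel_singleton)
    then show "AE b in lborel.
        norm (indicat_real {0..} b *\<^sub>R (exp (k * b) * hit_conv t ((b + v) / \<sigma>) m ((b + u) / \<sigma>') m'))
        \<le> norm (D * (indicat_real {0<..} b * (b powr (- 1 / 2) * exp (- b))))"
    proof eventually_elim
      fix b :: real
      assume "b \<noteq> 0"
      show "norm (indicat_real {0..} b *\<^sub>R (exp (k * b) * hit_conv t ((b + v) / \<sigma>) m ((b + u) / \<sigma>') m'))
        \<le> norm (D * (indicat_real {0<..} b * (b powr (- 1 / 2) * exp (- b))))"
      proof (cases "b < 0")
        case False
        with \<open>b \<noteq> 0\<close> have b: "b > 0"
          by simp
        have "exp (k * b) * hit_conv t ((b + v) / \<sigma>) m ((b + u) / \<sigma>') m' \<le>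
          exp (k * b) * (C * (((b + v) / \<sigma>) powr (- 1 / 2) * exp (- L * ((b + u) / \<sigma>'))))"
          using assms b by (intro mult_left_mono C) (auto simp: divide_right_mono)
        also have "\<dots> \<le> exp (k * b) * (C * ((b * (1 / \<sigma>)) powr (- 1 / 2) * exp (- L * ((b + u) / \<sigma>'))))"
          using assms b C(1) by (intro mult_left_mono mult_right_mono powr_mono2')
            (auto simp: divide_right_mono)
        also have "\<dots> = C * (1 / \<sigma>) powr (- 1 / 2) * b powr (- 1 / 2) * exp (k * b + - L * ((b + u) / \<sigma>'))"
          using assms b by (simp only: powr_mult exp_add mult_ac)
        also have "k * b + - L * ((b + u) / \<sigma>') = - (k + 1) * u + - b"
          using assms by (simp add: L_def field_simps)
        also have "C * (1 / \<sigma>) powr (- 1 / 2) * b powr (- 1 / 2) * exp (- (k + 1) * u + - b)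
            = D * (b powr (- 1 / 2) * exp (- b))"
          by (simp only: D_def exp_add mult_ac)
        finally have "exp (k * b) * hit_conv t ((b + v) / \<sigma>) m ((b + u) / \<sigma>') m'
            \<le> D * (b powr (- 1 / 2) * exp (- b))" .
        with b C(1) show ?thesis
          by (simp add: abs_mult hit_conv_nonneg D_def)
      qed simp
    qed
  qed
qed

text \<open>Allows the common integral to be cancelled when the two diffusion coefficients are
  compared.\<close>

lemma integral_exp_mult_hit_conv_pos:
  assumes "t > 0" "\<sigma> > 0" "\<sigma>' > 0" "v \<ge> 0" "u > 0"
  shows "0 < (LBINT b:{0..}. exp (k * b) * hit_conv t ((b + v) / \<sigma>) m ((b + u) / \<sigma>') m')"
  by (rule set_integral_pos[OF integrable_exp_mult_hit_conv, where c = 0 and d = 1])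
    (use assms in \<open>auto simp: hit_conv_nonneg hit_conv_pos\<close>)

text \<open>Both integrands are integrable, so the difference of the integrals is the integral of a
  function that is positive for \<open>b > 0\<close>.\<close>

lemma integral_exp_mult_hit_conv_strict_mono:
  assumes "t > 0" "\<sigma> > 0" "\<sigma>' > 0" "v \<ge> 0" "u > 0" "k < l"
  shows "(LBINT b:{0..}. exp (k * b) * hit_conv t ((b + v) / \<sigma>) m ((b + u) / \<sigma>') m')
      < (LBINT b:{0..}. exp (l * b) * hit_conv t ((b + v) / \<sigma>) m ((b + u) / \<sigma>') m')"
proof -
  let ?G = "\<lambda>b. hit_conv t ((b + v) / \<sigma>) m ((b + u) / \<sigma>') m'"
  have int: "set_integrable lborel {0..} (\<lambda>b. exp (r * b) * ?G b)" for r
    using assms by (intro integrable_exp_mult_hit_conv) auto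
  have "0 < (LBINT b:{0..}. exp (l * b) * ?G b - exp (k * b) * ?G b)"
    by (rule set_integral_pos[OF set_integral_diff(1)[OF int int], where c = 0 and d = 1])
      (use assms in \<open>auto simp: hit_conv_nonneg hit_conv_pos intro!: mult_right_mono mult_strict_right_mono\<close>)
  then show ?thesis
    by (simp add: set_integral_diff(2)[OF int int])
qed

section \<open>The transition density and its dual in terms of \<open>hit_conv\<close>\<close>

lemma density_version_above:
  assumes "x \<ge> a" "z \<ge> a"
  shows "density_version a \<mu>\<^sub>1 \<mu>\<^sub>2 \<sigma>\<^sub>1 \<sigma>\<^sub>2 t x z =
    2 / \<sigma>\<^sub>2\<^sup>2 * exp (2 * \<mu>\<^sub>2 * (z - a) / \<sigma>\<^sub>2\<^sup>2) * (LBINT b:{0..}. exp (2 * \<mu>\<^sub>1 / \<sigma>\<^sub>1\<^sup>2 * b) *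
      hit_conv t ((b + 0) / \<sigma>\<^sub>1) (\<mu>\<^sub>1 / \<sigma>\<^sub>1) ((b + (z + x - 2 * a)) / \<sigma>\<^sub>2) (\<mu>\<^sub>2 / \<sigma>\<^sub>2))
    + 1 / sqrt (2 * pi * t * \<sigma>\<^sub>2\<^sup>2) * (exp (- ((z - x - \<mu>\<^sub>2 * t)\<^sup>2 / (2 * t * \<sigma>\<^sub>2\<^sup>2)))
              - exp (- ((z + x - 2 * a - \<mu>\<^sub>2 * t)\<^sup>2 / (2 * t * \<sigma>\<^sub>2\<^sup>2))
                     - 2 * \<mu>\<^sub>2 * (x - a) / \<sigma>\<^sub>2\<^sup>2))"
  using assms by (simp add: density_version_def hit_conv_def mult.assoc add_ac)

text \<open>
  For equal diffusion coefficients this form is also valid at \<open>z = a\<close>, where the Gaussian terms cancel;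
  it is needed there because \<open>density_version\<close> treats a start at \<open>a\<close> as a start above \<open>a\<close>.
\<close>
lemma density_version_across:
  assumes "x \<ge> a" "z < a \<or> z = a \<and> \<sigma>\<^sub>1 = \<sigma>\<^sub>2" "t > 0" "\<sigma>\<^sub>2 > 0"
  shows "density_version a \<mu>\<^sub>1 \<mu>\<^sub>2 \<sigma>\<^sub>1 \<sigma>\<^sub>2 t x z =
    2 / \<sigma>\<^sub>1\<^sup>2 * (LBINT b:{0..}. exp (2 * \<mu>\<^sub>1 / \<sigma>\<^sub>1\<^sup>2 * b) *
      hit_conv t ((b + (a - z)) / \<sigma>\<^sub>1) (\<mu>\<^sub>1 / \<sigma>\<^sub>1) ((b + (x - a)) / \<sigma>\<^sub>2) (\<mu>\<^sub>2 / \<sigma>\<^sub>2))"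
proof (cases "z < a")
  case True
  have shift: "b - z + a = b + (a - z)" "x - a + b = b + (x - a)" for b
    by simp_all
  show ?thesis
    using True assms by (simp add: density_version_def hit_conv_def mult.assoc shift)
next
  case False
  with assms have z: "z = a" "\<sigma>\<^sub>1 = \<sigma>\<^sub>2"
    by auto
  have "- ((z - x - \<mu>\<^sub>2 * t)\<^sup>2 / (2 * t * \<sigma>\<^sub>2\<^sup>2)) =
      - ((z + x - 2 * a - \<mu>\<^sub>2 * t)\<^sup>2 / (2 * t * \<sigma>\<^sub>2\<^sup>2)) - 2 * \<mu>\<^sub>2 * (x - a) / \<sigma>\<^sub>2\<^sup>2"
    using assms z by (simp add: field_simps power2_eq_square)
  then show ?thesis
    using assms z by (simp add: density_version_above)
qed

text \<open>Negating space swaps the half-lines with their coefficients and flips the drifts, so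
  starts below \<open>a\<close> reduce to starts above \<open>- a\<close>. The branch
  \<open>z \<le> a\<close> maps exactly to the closed upper branch.\<close>

lemma density_version_reflect:
  assumes "x < a"
  shows "density_version a \<mu>\<^sub>1 \<mu>\<^sub>2 \<sigma>\<^sub>1 \<sigma>\<^sub>2 t x z
    = density_version (- a) (- \<mu>\<^sub>2) (- \<mu>\<^sub>1) \<sigma>\<^sub>2 \<sigma>\<^sub>1 t (- x) (- z)"
proof -
  have *: "(LBINT b:{..0}. f b) = (LBINT b:{0..}. f (- b))" for f :: "real \<Rightarrow> real"
    by (subst set_integral_reflect) (simp add: atLeast_def)
  have hit: "hit s (y / r) (m / r) = hit s (y' / r) (- m / r)" if "y = - y'" for s y y' r m
    using hit_minus[of s "y' / r" "m / r"] that by simp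
  \<comment> \<open>The right-hand sides keep terms such as \<open>- - a\<close> because they must
    match the unfolded reflected density literally.\<close>
  have h: "hit s ((z + x - 2 * a + - b) / \<sigma>\<^sub>1) (\<mu>\<^sub>1 / \<sigma>\<^sub>1) = hit s ((- z + - x - 2 * - a + b) / \<sigma>\<^sub>1) (- \<mu>\<^sub>1 / \<sigma>\<^sub>1)"
    "hit s (- b / \<sigma>\<^sub>2) (\<mu>\<^sub>2 / \<sigma>\<^sub>2) = hit s (b / \<sigma>\<^sub>2) (- \<mu>\<^sub>2 / \<sigma>\<^sub>2)"
    "hit s ((- b - z + a) / \<sigma>\<^sub>2) (\<mu>\<^sub>2 / \<sigma>\<^sub>2) = hit s ((b - - z + - a) / \<sigma>\<^sub>2) (- \<mu>\<^sub>2 / \<sigma>\<^sub>2)"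
    "hit s ((x - a + - b) / \<sigma>\<^sub>1) (\<mu>\<^sub>1 / \<sigma>\<^sub>1) = hit s ((- x - - a + b) / \<sigma>\<^sub>1) (- \<mu>\<^sub>1 / \<sigma>\<^sub>1)"
    for s b
    by (rule hit; simp)+
  have e: "2 * \<mu>\<^sub>1 * (z - a) = 2 * - \<mu>\<^sub>1 * (- z - - a)" "2 * \<mu>\<^sub>1 * (x - a) = 2 * - \<mu>\<^sub>1 * (- x - - a)"
    "2 * \<mu>\<^sub>2 * - b = 2 * - \<mu>\<^sub>2 * b"
    "(z - x - \<mu>\<^sub>1 * t)\<^sup>2 = (- z - - x - - \<mu>\<^sub>1 * t)\<^sup>2"
    "(z + x - 2 * a - \<mu>\<^sub>1 * t)\<^sup>2 = (- z + - x - 2 * - a - - \<mu>\<^sub>1 * t)\<^sup>2" for b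
    by (simp_all add: power2_eq_square algebra_simps)
  have c: "(x \<ge> a) = False" "(- x \<ge> - a) = True"
    using assms by auto
  show ?thesis
  proof (cases "z \<le> a")
    case True
    then have "(- z \<ge> - a) = True"
      by simp
    with True show ?thesis
      unfolding density_version_def * c h e if_True if_False by (simp only: if_True)
  next
    case False
    then have "(- z \<ge> - a) = False"
      by simp
    with False show ?thesis
      unfolding density_version_def * c h e if_True if_False by (simp only: if_False)
  qed
qed

lemma density_version_dual_above:
  assumes "x \<ge> a" "z \<ge> a" "\<sigma>\<^sub>1 > 0" "\<sigma>\<^sub>2 > 0" "t > 0"
  shows "density_version a (- \<mu>\<^sub>1) (- \<mu>\<^sub>2) \<sigma>\<^sub>1 \<sigma>\<^sub>2 t z x =
    2 / \<sigma>\<^sub>2\<^sup>2 * exp (2 * \<mu>\<^sub>2 * (z - a) / \<sigma>\<^sub>2\<^sup>2) * (LBINT b:{0..}. exp (2 * \<mu>\<^sub>2 / \<sigma>\<^sub>2\<^sup>2 * b) *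
      hit_conv t ((b + 0) / \<sigma>\<^sub>1) (\<mu>\<^sub>1 / \<sigma>\<^sub>1) ((b + (z + x - 2 * a)) / \<sigma>\<^sub>2) (\<mu>\<^sub>2 / \<sigma>\<^sub>2))
    + 1 / sqrt (2 * pi * t * \<sigma>\<^sub>2\<^sup>2) * (exp (- ((z - x - \<mu>\<^sub>2 * t)\<^sup>2 / (2 * t * \<sigma>\<^sub>2\<^sup>2)))
              - exp (- ((z + x - 2 * a - \<mu>\<^sub>2 * t)\<^sup>2 / (2 * t * \<sigma>\<^sub>2\<^sup>2))
                     - 2 * \<mu>\<^sub>2 * (x - a) / \<sigma>\<^sub>2\<^sup>2))"
proof -
  let ?G = "\<lambda>b. hit_conv t ((b + 0) / \<sigma>\<^sub>1) (\<mu>\<^sub>1 / \<sigma>\<^sub>1) ((b + (z + x - 2 * a)) / \<sigma>\<^sub>2) (\<mu>\<^sub>2 / \<sigma>\<^sub>2)"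
  have conv: "exp (2 * - \<mu>\<^sub>2 * (x - a) / \<sigma>\<^sub>2\<^sup>2) * (exp (2 * - \<mu>\<^sub>1 / \<sigma>\<^sub>1\<^sup>2 * b) *
      hit_conv t ((b + 0) / \<sigma>\<^sub>1) (- \<mu>\<^sub>1 / \<sigma>\<^sub>1) ((b + (x + z - 2 * a)) / \<sigma>\<^sub>2) (- \<mu>\<^sub>2 / \<sigma>\<^sub>2)) =
      exp (2 * \<mu>\<^sub>2 * (z - a) / \<sigma>\<^sub>2\<^sup>2) * (exp (2 * \<mu>\<^sub>2 / \<sigma>\<^sub>2\<^sup>2 * b) * ?G b)" for b
  proof -
    \<comment> \<open>Drift reversal contributes
      \<open>exp (k\<^sub>1 b + k\<^sub>2 (b + z + x - 2 a))\<close>. This cancels the weight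
      \<open>exp (- k\<^sub>1 b)\<close> and turns \<open>exp (- k\<^sub>2 (x - a))\<close> into
      \<open>exp (k\<^sub>2 (z - a)) * exp (k\<^sub>2 b)\<close>.\<close>
    have "2 * - \<mu>\<^sub>2 * (x - a) / \<sigma>\<^sub>2\<^sup>2 + (2 * - \<mu>\<^sub>1 / \<sigma>\<^sub>1\<^sup>2 * b +
          (2 * (\<mu>\<^sub>1 / \<sigma>\<^sub>1) * ((b + 0) / \<sigma>\<^sub>1) + 2 * (\<mu>\<^sub>2 / \<sigma>\<^sub>2) * ((b + (z + x - 2 * a)) / \<sigma>\<^sub>2)))
        = 2 * \<mu>\<^sub>2 * (z - a) / \<sigma>\<^sub>2\<^sup>2 + 2 * \<mu>\<^sub>2 / \<sigma>\<^sub>2\<^sup>2 * b"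
      using assms by (simp add: field_simps power2_eq_square)
    then show ?thesis
      unfolding minus_divide_left[symmetric] hit_conv_minus_drift add.commute[of x z]
      by (simp only: mult.assoc[symmetric] exp_add[symmetric] add.assoc)
  qed
  have "exp (2 * - \<mu>\<^sub>2 * (x - a) / \<sigma>\<^sub>2\<^sup>2) * (LBINT b:{0..}. exp (2 * - \<mu>\<^sub>1 / \<sigma>\<^sub>1\<^sup>2 * b) *
      hit_conv t ((b + 0) / \<sigma>\<^sub>1) (- \<mu>\<^sub>1 / \<sigma>\<^sub>1) ((b + (x + z - 2 * a)) / \<sigma>\<^sub>2) (- \<mu>\<^sub>2 / \<sigma>\<^sub>2)) =
      exp (2 * \<mu>\<^sub>2 * (z - a) / \<sigma>\<^sub>2\<^sup>2) * (LBINT b:{0..}. exp (2 * \<mu>\<^sub>2 / \<sigma>\<^sub>2\<^sup>2 * b) * ?G b)"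
    unfolding set_integral_mult_right[symmetric] conv ..
  moreover have "(x - z - - \<mu>\<^sub>2 * t)\<^sup>2 = (z - x - \<mu>\<^sub>2 * t)\<^sup>2"
    by (simp add: power2_eq_square algebra_simps)
  moreover have "- ((x + z - 2 * a - - \<mu>\<^sub>2 * t)\<^sup>2 / (2 * t * \<sigma>\<^sub>2\<^sup>2)) - 2 * - \<mu>\<^sub>2 * (z - a) / \<sigma>\<^sub>2\<^sup>2 =
      - ((z + x - 2 * a - \<mu>\<^sub>2 * t)\<^sup>2 / (2 * t * \<sigma>\<^sub>2\<^sup>2)) - 2 * \<mu>\<^sub>2 * (x - a) / \<sigma>\<^sub>2\<^sup>2"
    using assms by (simp add: field_simps power2_eq_square)
  ultimately show ?thesis
    unfolding density_version_above[OF assms(2,1)] mult.assoc by simp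
qed

text \<open>Reflection undoes the sign change of the drifts and puts the start above the interface,
  so \<open>density_version_across\<close> applies; commuting the convolution restores the order of
  the kernels.\<close>

lemma density_version_dual_across:
  assumes "x > a \<or> x = a \<and> \<sigma>\<^sub>1 = \<sigma>\<^sub>2" "z < a" "t > 0" "\<sigma>\<^sub>1 > 0"
  shows "density_version a (- \<mu>\<^sub>1) (- \<mu>\<^sub>2) \<sigma>\<^sub>1 \<sigma>\<^sub>2 t z x =
    2 / \<sigma>\<^sub>2\<^sup>2 * (LBINT b:{0..}. exp (2 * \<mu>\<^sub>2 / \<sigma>\<^sub>2\<^sup>2 * b) *
      hit_conv t ((b + (a - z)) / \<sigma>\<^sub>1) (\<mu>\<^sub>1 / \<sigma>\<^sub>1) ((b + (x - a)) / \<sigma>\<^sub>2) (\<mu>\<^sub>2 / \<sigma>\<^sub>2))"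
proof -
  have "density_version a (- \<mu>\<^sub>1) (- \<mu>\<^sub>2) \<sigma>\<^sub>1 \<sigma>\<^sub>2 t z x
      = density_version (- a) \<mu>\<^sub>2 \<mu>\<^sub>1 \<sigma>\<^sub>2 \<sigma>\<^sub>1 t (- z) (- x)"
    using assms density_version_reflect[of z a "- \<mu>\<^sub>1" "- \<mu>\<^sub>2" \<sigma>\<^sub>1 \<sigma>\<^sub>2 t x] by simp
  also have "\<dots> = 2 / \<sigma>\<^sub>2\<^sup>2 * (LBINT b:{0..}. exp (2 * \<mu>\<^sub>2 / \<sigma>\<^sub>2\<^sup>2 * b) *
      hit_conv t ((b + (- a - - x)) / \<sigma>\<^sub>2) (\<mu>\<^sub>2 / \<sigma>\<^sub>2) ((b + (- z - - a)) / \<sigma>\<^sub>1) (\<mu>\<^sub>1 / \<sigma>\<^sub>1))"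
    using assms by (intro density_version_across) auto
  finally show ?thesis
    by (subst hit_conv_commute) simp
qed

text \<open>With equal coefficients the weights and prefactors of the direct and dual formulas
  agree. For \<open>x < a \<le> z\<close> the roles of \<open>x\<close> and \<open>z\<close> are
  exchanged and \<open>\<mu>\<close> is negated; two points below \<open>a\<close> are
  reflected.\<close>

lemma density_version_dual_homogeneous:
  assumes "\<sigma> > 0" "t > 0"
  shows "density_version a \<mu> \<mu> \<sigma> \<sigma> t x z = density_version a (- \<mu>) (- \<mu>) \<sigma> \<sigma> t z x"
proof -
  have above: "density_version a \<mu> \<mu> \<sigma> \<sigma> t x z = density_version a (- \<mu>) (- \<mu>) \<sigma> \<sigma> t z x"
    if "x \<ge> a" "z \<ge> a" for a \<mu> x z
    by (rule trans[OF density_version_above density_version_dual_above[symmetric]])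
      (use assms that in auto)
  have across: "density_version a \<mu> \<mu> \<sigma> \<sigma> t x z = density_version a (- \<mu>) (- \<mu>) \<sigma> \<sigma> t z x"
    if "x \<ge> a" "z < a" for \<mu> x z
    by (rule trans[OF density_version_across density_version_dual_across[symmetric]])
      (use assms that in auto)
  consider "x \<ge> a" "z \<ge> a" | "x \<ge> a" "z < a" | "x < a" "z \<ge> a" | "x < a" "z < a"
    by linarith
  then show ?thesis
  proof cases
    case 3
    then show ?thesis
      using across[of z x "- \<mu>"] by simp
  next
    case 4
    then show ?thesis
      using above[of "- a" "- x" "- z" "- \<mu>"]
        density_version_reflect[of x a \<mu> \<mu> \<sigma> \<sigma> t z]
        density_version_reflect[of z a "- \<mu>" "- \<mu>" \<sigma> \<sigma> t x] by simp
  qed (auto intro: above across)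
qed

section \<open>Necessity and sufficiency of equal coefficients\<close>

theorem mainTheorem5:
  fixes M :: "'w measure" and F :: "real \<Rightarrow> 'w measure" and B :: "real \<Rightarrow> 'w \<Rightarrow> real"
    and X Z :: "real \<Rightarrow> real \<Rightarrow> 'w \<Rightarrow> real"
    and p\<^sub>X p\<^sub>Z :: "real \<Rightarrow> real \<Rightarrow> real \<Rightarrow> real"
    and a \<mu>\<^sub>1 \<mu>\<^sub>2 \<sigma>\<^sub>1 \<sigma>\<^sub>2 :: real
  assumes "\<sigma>\<^sub>1 > 0" and "\<sigma>\<^sub>2 > 0"
    and "brownian_motion M F B"
    and "\<And>x. sde_solution M F B (two_valued a \<mu>\<^sub>1 \<mu>\<^sub>2) (two_valued a \<sigma>\<^sub>1 \<sigma>\<^sub>2) x (X x)"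
    and "\<And>x. sde_solution M F B (two_valued a (- \<mu>\<^sub>1) (- \<mu>\<^sub>2)) (two_valued a \<sigma>\<^sub>1 \<sigma>\<^sub>2) x (Z x)"
    and "transition_density M X p\<^sub>X"
    and "\<And>t x z. t > 0 \<Longrightarrow> p\<^sub>X t x z = density_version a \<mu>\<^sub>1 \<mu>\<^sub>2 \<sigma>\<^sub>1 \<sigma>\<^sub>2 t x z"
    and "transition_density M Z p\<^sub>Z"
    and "\<And>t x z. t > 0 \<Longrightarrow> p\<^sub>Z t x z = density_version a (- \<mu>\<^sub>1) (- \<mu>\<^sub>2) \<sigma>\<^sub>1 \<sigma>\<^sub>2 t x z"
  shows "(\<forall>t>0. \<forall>x z. p\<^sub>X t x z = p\<^sub>Z t z x) \<longleftrightarrow> \<mu>\<^sub>1 = \<mu>\<^sub>2 \<and> \<sigma>\<^sub>1 = \<sigma>\<^sub>2"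
proof
  assume "\<forall>t>0. \<forall>x z. p\<^sub>X t x z = p\<^sub>Z t z x"
  then have sym: "density_version a \<mu>\<^sub>1 \<mu>\<^sub>2 \<sigma>\<^sub>1 \<sigma>\<^sub>2 1 x z = density_version a (- \<mu>\<^sub>1) (- \<mu>\<^sub>2) \<sigma>\<^sub>1 \<sigma>\<^sub>2 1 z x" for x z
    using assms(7,9) by (metis zero_less_one)
  let ?k1 = "2 * \<mu>\<^sub>1 / \<sigma>\<^sub>1\<^sup>2" and ?k2 = "2 * \<mu>\<^sub>2 / \<sigma>\<^sub>2\<^sup>2"
  define G where "G v u b = hit_conv 1 ((b + v) / \<sigma>\<^sub>1) (\<mu>\<^sub>1 / \<sigma>\<^sub>1) ((b + u) / \<sigma>\<^sub>2) (\<mu>\<^sub>2 / \<sigma>\<^sub>2)" for v u b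
  \<comment> \<open>At \<open>x = z = a + 1\<close> the prefactors and Gaussian terms agree, so only
    the weights remain to be compared.\<close>
  have eq: "(LBINT b:{0..}. exp (?k1 * b) * G 0 2 b) = (LBINT b:{0..}. exp (?k2 * b) * G 0 2 b)"
    using sym[of "a + 1" "a + 1"] density_version_above[of a "a + 1" "a + 1" \<mu>\<^sub>1 \<mu>\<^sub>2 \<sigma>\<^sub>1 \<sigma>\<^sub>2 1]
      density_version_dual_above[of a "a + 1" "a + 1" \<sigma>\<^sub>1 \<sigma>\<^sub>2 1 \<mu>\<^sub>1 \<mu>\<^sub>2] assms(1,2)
    by (simp add: G_def)
  have less: "(LBINT b:{0..}. exp (k * b) * G 0 2 b) < (LBINT b:{0..}. exp (l * b) * G 0 2 b)"
    if "k < l" for k l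
    unfolding G_def using that assms(1,2) by (intro integral_exp_mult_hit_conv_strict_mono) auto
  have k: "?k1 = ?k2"
    using less[of ?k1 ?k2] less[of ?k2 ?k1] eq by linarith
  \<comment> \<open>The points \<open>a + 1\<close> and \<open>a - 1\<close> lie on opposite sides
    of the interface and give \<open>v = u = 1\<close>; there the two formulas carry different
    prefactors.\<close>
  have "0 < (LBINT b:{0..}. exp (?k2 * b) * G 1 1 b)"
    unfolding G_def using assms(1,2) by (intro integral_exp_mult_hit_conv_pos) auto
  moreover have "2 / \<sigma>\<^sub>1\<^sup>2 * (LBINT b:{0..}. exp (?k1 * b) * G 1 1 b)
      = 2 / \<sigma>\<^sub>2\<^sup>2 * (LBINT b:{0..}. exp (?k2 * b) * G 1 1 b)"
    using sym[of "a + 1" "a - 1"] density_version_across[of a "a + 1" "a - 1" \<sigma>\<^sub>1 \<sigma>\<^sub>2 1 \<mu>\<^sub>1 \<mu>\<^sub>2]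
      density_version_dual_across[of a "a + 1" \<sigma>\<^sub>1 \<sigma>\<^sub>2 "a - 1" 1 \<mu>\<^sub>1 \<mu>\<^sub>2] assms(1,2)
    by (simp add: G_def)
  ultimately have "2 / \<sigma>\<^sub>1\<^sup>2 = 2 / \<sigma>\<^sub>2\<^sup>2"
    unfolding k by simp
  then have "\<sigma>\<^sub>1 = \<sigma>\<^sub>2"
    using assms(1,2) by simp
  with k assms(2) show "\<mu>\<^sub>1 = \<mu>\<^sub>2 \<and> \<sigma>\<^sub>1 = \<sigma>\<^sub>2"
    by simp
next
  assume "\<mu>\<^sub>1 = \<mu>\<^sub>2 \<and> \<sigma>\<^sub>1 = \<sigma>\<^sub>2"
  then show "\<forall>t>0. \<forall>x z. p\<^sub>X t x z = p\<^sub>Z t z x"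
    using assms(7,9) density_version_dual_homogeneous[OF assms(2)] by metis
qed

end
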